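(* For any graph $G$ with chromatic number $\chi(G)\ge 3$, we have $s(n,G)=(1+o(1))\mathrm{ex}(n,G)$ as $n\to\infty$. If $G$ is bipartite, then $s(n,G)=o(n^2)$.
   Context: For a graph $H$, $F_{H,0}$ is the set of maps $f:E(H)\to E(H)$ with $f(e)\cap e=\emptyset$ for every $e\in E(H)$. Given such an $f$, a subgraph $G'$ of $H$ is $f$-exclusive if $f(e)\cap V(G')=\emptyset$ for every $e\in E(G')$. For $n\ge 4$, $s(n,G)$ is the maximum number of edges of an $n$-vertex graph $H$ for which some $f\in F_{H,0}$ exists with no $f$-exclusive copy of $G$ in $H$. $\mathrm{ex}(n,G)$ is the Turán number. *)

theory Defs
  imports "HOL-Library.FuncSet" "HOL-Library.Landau_Symbols"
begin

type_synonym 'a ugraph = "'a set \<times> 'a set set"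

abbreviation verts :: "'a ugraph \<Rightarrow> 'a set" where
  "verts G \<equiv> fst G"

abbreviation edges :: "'a ugraph \<Rightarrow> 'a set set" where
  "edges G \<equiv> snd G"

definition simple_graph :: "'a ugraph \<Rightarrow> bool" where
  "simple_graph G \<longleftrightarrow> finite (verts G) \<and> (\<forall>e\<in>edges G. e \<subseteq> verts G \<and> card e = 2)"

definition subgraph :: "'a ugraph \<Rightarrow> 'a ugraph \<Rightarrow> bool" where
  "subgraph G' H \<longleftrightarrow> simple_graph G' \<and> verts G' \<subseteq> verts H \<and> edges G' \<subseteq> edges H"

definition isomorphic :: "'a ugraph \<Rightarrow> 'b ugraph \<Rightarrow> bool" where
  "isomorphic G G' \<longleftrightarrow>
     (\<exists>\<phi>. bij_betw \<phi> (verts G) (verts G') \<and> edges G' = (\<lambda>e. \<phi> ` e) ` edges G)"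

definition is_copy :: "'a ugraph \<Rightarrow> 'b ugraph \<Rightarrow> 'b ugraph \<Rightarrow> bool" where
  "is_copy G H G' \<longleftrightarrow> subgraph G' H \<and> isomorphic G G'"

definition proper_colouring :: "'a ugraph \<Rightarrow> nat \<Rightarrow> ('a \<Rightarrow> nat) \<Rightarrow> bool" where
  "proper_colouring G k c \<longleftrightarrow>
     c \<in> verts G \<rightarrow> {..<k} \<and> (\<forall>u v. {u, v} \<in> edges G \<longrightarrow> c u \<noteq> c v)"

definition chromatic_number :: "'a ugraph \<Rightarrow> nat" where
  "chromatic_number G = (LEAST k. \<exists>c. proper_colouring G k c)"

definition bipartite :: "'a ugraph \<Rightarrow> bool" where
  "bipartite G \<longleftrightarrow>
     (\<exists>A B. A \<union> B = verts G \<and> A \<inter> B = {} \<and> (\<forall>e\<in>edges G. \<exists>a\<in>A. \<exists>b\<in>B. e = {a, b}))"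

definition F0 :: "'a ugraph \<Rightarrow> ('a set \<Rightarrow> 'a set) set" where
  "F0 H = {f \<in> edges H \<rightarrow>\<^sub>E edges H. \<forall>e\<in>edges H. f e \<inter> e = {}}"

definition exclusive :: "('a set \<Rightarrow> 'a set) \<Rightarrow> 'a ugraph \<Rightarrow> bool" where
  "exclusive f G' \<longleftrightarrow> (\<forall>e\<in>edges G'. f e \<inter> verts G' = {})"

text \<open>
  The host graphs below have vertices in \<^typ>\<open>nat\<close>, which loses nothing: every finite
  graph is isomorphic to such a graph.

  The edge counts of graphs on \<open>n\<close> vertices are bounded, so \<^const>\<open>Sup\<close> over a set
  of them is its maximum, or \<open>0\<close> if the set is empty. It is empty exactly when every
  candidate graph contains the required copy, as for edgeless \<open>G\<close> on at most \<open>n\<close>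
  vertices; if \<open>G\<close> has an edge, the edgeless graph on \<open>n\<close> vertices is a candidate.
\<close>

definition ex :: "nat \<Rightarrow> 'a ugraph \<Rightarrow> nat" where
  "ex n G = Sup {card (edges H) | H :: nat ugraph.
     simple_graph H \<and> card (verts H) = n \<and> \<not> (\<exists>G'. is_copy G H G')}"

definition s :: "nat \<Rightarrow> 'a ugraph \<Rightarrow> nat" where
  "s n G = Sup {card (edges H) | H :: nat ugraph.
     simple_graph H \<and> card (verts H) = n \<and>
     (\<exists>f\<in>F0 H. \<not> (\<exists>G'. is_copy G H G' \<and> exclusive f G'))}"

end

theory Submission
  imports Defs "HOL-Real_Asymp.Real_Asymp"
begin

text \<open>If \<open>f\<close> admits no exclusive copy of \<open>G\<close> in \<open>H\<close>, then for every \<open>m\<close>-set \<open>S\<close> of vertices the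
  edges \<open>e \<subseteq> S\<close> with \<open>f e\<close> disjoint from \<open>S\<close> form a \<open>G\<close>-free graph. Averaging over \<open>S\<close> shows that,
  for each fixed \<open>m\<close>, \<open>limsup s(n,G)/n(n-1) \<le> ex(m,G)/m(m-1)\<close>. Since \<open>ex(n,G) \<le> s(n,G)\<close> for large \<open>n\<close>
  when \<open>\<chi>(G) \<ge> 3\<close>, both \<open>s(n,G)/n(n-1)\<close> and \<open>ex(n,G)/n(n-1)\<close> then tend to the infimum of the right-hand
  sides, which is positive by the balanced complete bipartite graphs. For bipartite \<open>G\<close> the infimum is \<open>0\<close>
  by the Kovari--Sos--Turan theorem.\<close>

section \<open>Extremal numbers as maxima\<close>

lemma simple_graph_finite_edges:
  assumes "simple_graph H"
  shows "finite (edges H)"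
  using assms by (intro finite_subset[of "edges H" "Pow (verts H)"]) (auto simp: simple_graph_def)

lemma card_edges_le:
  assumes "simple_graph H"
  shows "card (edges H) \<le> 2 ^ card (verts H)"
proof -
  have "card (edges H) \<le> card (Pow (verts H))"
    using assms by (intro card_mono) (auto simp: simple_graph_def)
  then show ?thesis using assms by (simp add: card_Pow simple_graph_def)
qed

text \<open>Edge counts on \<open>n\<close> vertices are at most \<open>2 ^ n\<close>, so a nonempty
  set of them attains its supremum. The alternative \<open>Sup X = 0\<close> covers the empty set,
  whose supremum in \<open>nat\<close> is \<open>0\<close>. The predicate \<open>P\<close> is left
  open so that \<open>ex\<close> and \<open>s\<close> are both instances.\<close>

lemma
  fixes P :: "nat ugraph \<Rightarrow> bool" and n :: nat
  defines "X \<equiv> {card (edges H) | H. simple_graph H \<and> card (verts H) = n \<and> P H}"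
  shows card_edges_le_Sup:
      "simple_graph H \<Longrightarrow> card (verts H) = n \<Longrightarrow> P H \<Longrightarrow> card (edges H) \<le> Sup X"
    and Sup_card_edges_cases:
      "Sup X = 0 \<or> (\<exists>H. simple_graph H \<and> card (verts H) = n \<and> P H \<and> card (edges H) = Sup X)"
proof -
  have "x \<le> 2 ^ n" if "x \<in> X" for x
    using that card_edges_le unfolding X_def by blast
  then have fin: "finite X" by (meson finite_nat_set_iff_bounded_le)
  show "card (edges H) \<le> Sup X" if "simple_graph H" "card (verts H) = n" "P H"
    using that fin by (intro cSup_upper bdd_above_finite) (unfold X_def, blast)+
  show "Sup X = 0 \<or> (\<exists>H. simple_graph H \<and> card (verts H) = n \<and> P H \<and> card (edges H) = Sup X)"
  proof (cases "X = {}")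
    case True
    then show ?thesis by (simp add: Sup_nat_def)
  next
    case False
    then have "Sup X \<in> X" using fin by (simp add: Sup_nat_def)
    then obtain H where "Sup X = card (edges H)" "simple_graph H" "card (verts H) = n" "P H"
      unfolding X_def by blast
    then show ?thesis by metis
  qed
qed

lemma card_edges_le_ex:
  fixes H :: "nat ugraph"
  assumes "simple_graph H" "card (verts H) = n" "\<nexists>G'. is_copy G H G'"
  shows "card (edges H) \<le> ex n G"
  unfolding ex_def using assms
  by (intro card_edges_le_Sup[where P = "\<lambda>H. \<nexists>G'. is_copy G H G'"])

lemma card_edges_le_s:
  fixes H :: "nat ugraph"
  assumes "simple_graph H" "card (verts H) = n" "f \<in> F0 H"
    and "\<nexists>G'. is_copy G H G' \<and> exclusive f G'"
  shows "card (edges H) \<le> s n G"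
  unfolding s_def using assms
  by (intro card_edges_le_Sup[where P = "\<lambda>H. \<exists>f\<in>F0 H. \<nexists>G'. is_copy G H G' \<and> exclusive f G'"]) blast+

lemma ex_cases:
  obtains "ex n G = 0"
  | H :: "nat ugraph" where "simple_graph H" "card (verts H) = n"
    "\<nexists>G'. is_copy G H G'" "card (edges H) = ex n G"
  using Sup_card_edges_cases[of n "\<lambda>H. \<nexists>G'. is_copy G H G'"] that
  unfolding ex_def[symmetric] by metis

lemma s_cases:
  obtains "s n G = 0"
  | H :: "nat ugraph" and f where "simple_graph H" "card (verts H) = n" "f \<in> F0 H"
    "\<nexists>G'. is_copy G H G' \<and> exclusive f G'" "card (edges H) = s n G"
  using Sup_card_edges_cases[of n "\<lambda>H. \<exists>f\<in>F0 H. \<nexists>G'. is_copy G H G' \<and> exclusive f G'"] that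
  unfolding s_def[symmetric] by metis

section \<open>Averaging over vertex sets of fixed size\<close>

text \<open>Removing \<open>A\<close> from \<open>S\<close> is a bijection onto the
  \<open>k\<close>-subsets of \<open>V - A - B\<close>.\<close>

lemma card_subsets_between:
  assumes "finite V" "A \<subseteq> V" "B \<subseteq> V" "A \<inter> B = {}"
  shows "card {S. S \<subseteq> V \<and> card S = card A + k \<and> A \<subseteq> S \<and> B \<inter> S = {}}
    = (card V - card A - card B) choose k"
proof -
  have fin: "finite A" "finite B" using assms by (auto intro: finite_subset)
  have "bij_betw (\<lambda>T. A \<union> T) {T. T \<subseteq> V - A - B \<and> card T = k}
     {S. S \<subseteq> V \<and> card S = card A + k \<and> A \<subseteq> S \<and> B \<inter> S = {}}"
  proof (rule bij_betw_byWitness[where f' = "\<lambda>S. S - A"])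
    show "(\<union>) A ` {T. T \<subseteq> V - A - B \<and> card T = k}
        \<subseteq> {S. S \<subseteq> V \<and> card S = card A + k \<and> A \<subseteq> S \<and> B \<inter> S = {}}"
    proof clarsimp
      fix T assume T: "T \<subseteq> V - A - B"
      then have "finite T" "A \<inter> T = {}" using assms(1) finite_subset by blast+
      then show "A \<subseteq> V \<and> T \<subseteq> V \<and> card (A \<union> T) = card A + card T \<and> B \<inter> (A \<union> T) = {}"
        using T assms fin by (auto simp: card_Un_disjoint)
    qed
    show "(\<lambda>S. S - A) ` {S. S \<subseteq> V \<and> card S = card A + k \<and> A \<subseteq> S \<and> B \<inter> S = {}}
        \<subseteq> {T. T \<subseteq> V - A - B \<and> card T = k}"
      using fin by (auto simp: card_Diff_subset)
  qed auto
  then have "card {S. S \<subseteq> V \<and> card S = card A + k \<and> A \<subseteq> S \<and> B \<inter> S = {}}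
      = card (V - A - B) choose k"
    using assms(1) by (simp add: bij_betw_same_card[symmetric] n_subsets)
  moreover have "card (V - A - B) = card V - card A - card B"
    using assms fin by (subst card_Diff_subset card_Diff_subset_Int; auto simp: card_Diff_subset)+
  ultimately show ?thesis by simp
qed

lemma sum_card_filter_swap:
  assumes "finite A" "finite B"
  shows "(\<Sum>x\<in>A. card {y \<in> B. P x y}) = (\<Sum>y\<in>B. card {x \<in> A. P x y})"
proof -
  have "(\<Sum>x\<in>A. \<Sum>y\<in>B. if P x y then 1 else 0::nat) = (\<Sum>y\<in>B. \<Sum>x\<in>A. if P x y then 1 else 0)"
    by (rule sum.swap)
  then show ?thesis using assms by (simp add: sum.If_cases Int_def)
qed

text \<open>The binomial on the left counts the \<open>m\<close>-sets \<open>S\<close> with \<open>e \<subseteq> S\<close> and \<open>f e\<close> disjoint from \<open>S\<close>, for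
  a fixed edge \<open>e\<close>.\<close>

lemma s_binomial_le:
  assumes "2 \<le> m"
  shows "s n G * ((n - 4) choose (m - 2)) \<le> (n choose m) * ex m G"
proof (cases rule: s_cases[of n G])
  case 1
  then show ?thesis by simp
next
  case (2 H f)
  let ?\<S> = "{S. S \<subseteq> verts H \<and> card S = m}"
  let ?E = "\<lambda>S. {e \<in> edges H. e \<subseteq> S \<and> f e \<inter> S = {}}"
  have fV: "finite (verts H)" and fE: "finite (edges H)"
    using 2(1) simple_graph_finite_edges[OF 2(1)] by (simp_all add: simple_graph_def)
  have edge: "e \<subseteq> verts H" "card e = 2" if "e \<in> edges H" for e
    using that 2(1) by (auto simp: simple_graph_def)
  have f: "f e \<in> edges H" "f e \<inter> e = {}" if "e \<in> edges H" for e
    using that 2(3) by (auto simp: F0_def)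
  have bound: "card (?E S) \<le> ex m G" if "S \<in> ?\<S>" for S
  proof -
    have "card (edges (S, ?E S)) \<le> ex m G"
    proof (rule card_edges_le_ex)
      show "simple_graph (S, ?E S)"
        using that fV finite_subset by (auto simp: simple_graph_def edge)
      show "card (verts (S, ?E S)) = m" using that by simp
      show "\<nexists>G'. is_copy G (S, ?E S) G'"
      proof
        assume "\<exists>G'. is_copy G (S, ?E S) G'"
        then obtain G' where "is_copy G (S, ?E S) G'" ..
        then have G': "simple_graph G'" "isomorphic G G'" "verts G' \<subseteq> S" "edges G' \<subseteq> ?E S"
          by (simp_all add: is_copy_def subgraph_def)
        \<comment> \<open>A copy inside the selected graph is exclusive: each of its edges
          \<open>e\<close> has \<open>f e\<close> disjoint from all of \<open>S\<close>, and its
          vertices lie in \<open>S\<close>.\<close>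
        then have "is_copy G H G'" using that unfolding is_copy_def subgraph_def by blast
        moreover have "exclusive f G'" using G' unfolding exclusive_def by blast
        ultimately show False using 2(4) by blast
      qed
    qed
    then show ?thesis by simp
  qed
  have count: "card {S \<in> ?\<S>. e \<subseteq> S \<and> f e \<inter> S = {}} = (n - 4) choose (m - 2)"
    if e: "e \<in> edges H" for e
  proof -
    \<comment> \<open>\<open>e\<close> and \<open>f e\<close> are disjoint edges: \<open>e\<close>
      fills two places of \<open>S\<close>, and four vertices are no longer free to choose.\<close>
    have "card e + (m - 2) = m" "card (verts H) - card e - card (f e) = n - 4"
      using edge f e assms 2(2) by simp_all
    moreover have "{S \<in> ?\<S>. e \<subseteq> S \<and> f e \<inter> S = {}}
        = {S. S \<subseteq> verts H \<and> card S = m \<and> e \<subseteq> S \<and> f e \<inter> S = {}}" by blast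
    ultimately show ?thesis
      using card_subsets_between[of "verts H" e "f e" "m - 2"] fV edge(1) f e
      by (simp add: Int_commute)
  qed
  have "s n G * ((n - 4) choose (m - 2)) = (\<Sum>e\<in>edges H. card {S \<in> ?\<S>. e \<subseteq> S \<and> f e \<inter> S = {}})"
    using count 2(5) by simp
  also have "\<dots> = (\<Sum>S\<in>?\<S>. card (?E S))"
    using fV fE by (intro sum_card_filter_swap) auto
  also have "\<dots> \<le> (\<Sum>S\<in>?\<S>. ex m G)" by (intro sum_mono bound)
  also have "\<dots> = (n choose m) * ex m G" using fV 2(2) by (simp add: n_subsets)
  finally show ?thesis .
qed

text \<open>Multiplied by \<open>fact p * fact q\<close>, both sides become
  \<open>fact (p + q + 4)\<close>. With \<open>n = p + q + 4\<close> and \<open>m = p + 2\<close>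
  this compares \<open>(n - 4) choose (m - 2)\<close> with \<open>n choose m\<close> free of
  truncated subtraction.\<close>

lemma binomial_minus_4:
  "(p + q + 4) * (p + q + 3) * (p + q + 2) * (p + q + 1) * ((p + q) choose p)
    = (p + 2) * (p + 1) * (q + 2) * (q + 1) * ((p + q + 4) choose (p + 2))"
proof -
  let ?n = "(p + q + 4) * (p + q + 3) * (p + q + 2) * (p + q + 1)"
  let ?m = "(p + 2) * (p + 1)" and ?l = "(q + 2) * (q + 1)"
  have fact_2: "fact (k + 2) = (k + 2) * (k + 1) * fact k" for k :: nat
    by (simp add: numeral_2_eq_2 algebra_simps)
  have "p + q + 2 + 2 = p + q + 4" "p + q + 2 + 1 = p + q + 3" by simp_all
  then have "fact (p + q + 4) = ?n * fact (p + q)"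
    using fact_2[of "p + q + 2"] fact_2[of "p + q"] by (simp only: mult.assoc)
  then have facts: "fact (p + 2) = ?m * fact p" "fact (q + 2) = ?l * fact q"
    "fact (p + q + 4) = ?n * fact (p + q)"
    by (simp_all only: fact_2)
  have "fact p * fact q * (?n * ((p + q) choose p)) = ?n * fact (p + q)"
    using binomial_fact_lemma[of p "p + q"] by simp
  also have "\<dots> = fact (p + 2) * fact (q + 2) * ((p + q + 4) choose (p + 2))"
    using binomial_fact_lemma[of "p + 2" "p + q + 4"] facts(3) by simp
  also have "\<dots> = fact p * fact q * (?m * ?l * ((p + q + 4) choose (p + 2)))"
    unfolding facts by (simp only: mult_ac)
  finally show ?thesis by (simp only: mult.assoc mult_cancel_left fact_nonzero simp_thms)
qed

text \<open>The two binomial coefficients in \<open>s_binomial_le\<close> are traded for polynomials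
  by \<open>binomial_minus_4\<close>, so that \<open>n\<close> can tend to infinity with
  \<open>m\<close> fixed.\<close>

lemma s_ratio_le:
  assumes "2 \<le> m" "m + 2 \<le> n"
  shows "real (s n G) * (real m * (real m - 1) * (real n - m) * (real n - m - 1))
    \<le> real (ex m G) * (real n * (real n - 1) * (real n - 2) * (real n - 3))"
proof -
  obtain p where p: "m = p + 2" using assms(1) by (metis add.commute le_Suc_ex)
  obtain q where q: "n = p + q + 4"
    using assms(2) unfolding p by (metis add.assoc add.commute le_Suc_ex numeral_Bit0)
  let ?C = "real ((p + q) choose p)" and ?D = "real ((p + q + 4) choose (p + 2))"
  let ?a = "real m * (real m - 1) * (real n - m) * (real n - m - 1)"
  let ?b = "real n * (real n - 1) * (real n - 2) * (real n - 3)"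
  have eq: "?b * ?C = ?a * ?D"
  proof -
    have *: "real n - 1 = real (p + q + 3)" "real n - 2 = real (p + q + 2)"
      "real n - 3 = real (p + q + 1)" "real m - 1 = real (p + 1)" "real n - m = real (q + 2)"
      "real (q + 2) - 1 = real (q + 1)"
      by (simp_all add: p q)
    show ?thesis unfolding * unfolding p q of_nat_mult[symmetric] binomial_minus_4 ..
  qed
  have D: "?D > 0" and b: "?b > 0"
    by (simp_all add: q)
  have "real (s n G * ((p + q) choose p)) \<le> real (((p + q + 4) choose (p + 2)) * ex m G)"
    using s_binomial_le[OF assms(1), of n G] unfolding of_nat_le_iff by (simp add: p q)
  then have "?b * (real (s n G) * ?C) \<le> ?b * (?D * real (ex m G))"
    using b by (intro mult_left_mono) auto
  moreover have "?b * (real (s n G) * ?C) = ?D * (real (s n G) * ?a)"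
    using arg_cong[OF eq, of "\<lambda>x. real (s n G) * x"] by (simp only: mult_ac)
  ultimately have "?D * (real (s n G) * ?a) \<le> ?D * (real (ex m G) * ?b)"
    by (simp only: mult_ac)
  then show ?thesis using D by (simp only: mult_le_cancel_left_pos)
qed

text \<open>For fixed \<open>m\<close>, the quotient of \<open>(n - 2) * (n - 3)\<close> by
  \<open>(n - m) * (n - m - 1)\<close> tends to 1, and the strict inequality assumed at
  \<open>m\<close> absorbs this error for large \<open>n\<close>.\<close>

lemma eventually_s_le:
  assumes "2 \<le> m" "real (ex m G) < c * (real m * (real m - 1))"
  shows "eventually (\<lambda>n. real (s n G) \<le> c * (real n * (real n - 1))) at_top"
proof -
  define M where "M = real m * (real m - 1)"
  have M: "M > 0" using assms(1) by (simp add: M_def)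
  have "((\<lambda>n. real (ex m G) * ((real n - 2) * (real n - 3) / ((real n - m) * (real n - m - 1))))
      \<longlongrightarrow> real (ex m G) * 1) at_top"
    by (intro tendsto_intros) real_asymp
  then have "eventually (\<lambda>n. real (ex m G) * ((real n - 2) * (real n - 3) / ((real n - m) * (real n - m - 1))) < c * M) at_top"
    using assms(2) by (intro order_tendstoD(2)) (auto simp: M_def)
  then show ?thesis
    using eventually_ge_at_top[of "m + 2"]
  proof eventually_elim
    case (elim n)
    define N where "N = (real n - m) * (real n - m - 1)"
    have N: "N > 0" using elim(2) by (simp add: N_def)
    have "real (s n G) * (M * N) \<le> real (ex m G) * (real n * (real n - 1) * (real n - 2) * (real n - 3))"
      using s_ratio_le[OF assms(1) elim(2), of G] by (simp add: M_def N_def mult_ac)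
    also have "\<dots> = (real n * (real n - 1)) * (real (ex m G) * ((real n - 2) * (real n - 3)))"
      by simp
    also have "\<dots> \<le> (real n * (real n - 1)) * (c * M * N)"
      using elim N by (intro mult_left_mono) (simp_all add: N_def[symmetric] pos_divide_less_eq)
    finally have "real (s n G) * (M * N) \<le> (c * (real n * (real n - 1))) * (M * N)" by (simp add: mult_ac)
    then show ?case using M N by (simp add: mult_le_cancel_right)
  qed
qed

section \<open>Chromatic number at least 3: lower bounds\<close>

lemma isomorphic_edge_image:
  assumes "isomorphic G G'"
  shows "\<exists>\<phi>. \<forall>u v. {u, v} \<in> edges G \<longrightarrow> {\<phi> u, \<phi> v} \<in> edges G'"
proof -
  from assms obtain \<phi> where "edges G' = (\<lambda>e. \<phi> ` e) ` edges G"
    unfolding isomorphic_def by blast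
  then have "{\<phi> u, \<phi> v} \<in> edges G'" if "{u, v} \<in> edges G" for u v
    using imageI[OF that, of "(`) \<phi>"] by simp
  then show ?thesis by blast
qed

text \<open>The balanced complete bipartite graph \<open>K\<close> is \<open>G\<close>-free, since a
  copy of \<open>G\<close> in it would pull its 2-colouring back to \<open>G\<close>. Its edge count
  gives the quadratic bound, and its existence ensures that \<open>ex n G\<close> is attained by a
  graph.\<close>

lemma ex_ge_of_chromatic_number:
  assumes "chromatic_number G \<ge> 3"
  obtains H :: "nat ugraph" where "simple_graph H" "card (verts H) = n"
    "\<nexists>G'. is_copy G H G'" "card (edges H) = ex n G" "n * (n - 1) \<le> 4 * ex n G"
proof -
  let ?k = "n div 2"
  define K :: "nat ugraph" where "K = ({..<n}, (\<lambda>(i, j). {i, j}) ` ({..<?k} \<times> {?k..<n}))"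
  have simple: "simple_graph K" by (auto simp: K_def simple_graph_def card_insert_if)
  have "inj_on (\<lambda>(i, j). {i, j}) ({..<?k} \<times> {?k..<n})"
    by (auto simp: inj_on_def doubleton_eq_iff)
  then have "card (edges K) = ?k * (n - ?k)" by (simp add: K_def card_image)
  moreover have "n * (n - 1) \<le> 4 * (?k * (n - ?k))"
  proof (cases "even n")
    case True
    then obtain l where "n = 2 * l" by blast
    then show ?thesis by (simp add: diff_mult_distrib2)
  next
    case False
    then obtain l where "n = 2 * l + 1" by (elim oddE)
    then show ?thesis by simp
  qed
  ultimately have large: "n * (n - 1) \<le> 4 * card (edges K)" by simp
  have free: "\<nexists>G'. is_copy G K G'"
  proof
    assume "\<exists>G'. is_copy G K G'"
    then obtain G' where G': "edges G' \<subseteq> edges K" "isomorphic G G'"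
      by (auto simp: is_copy_def subgraph_def)
    from isomorphic_edge_image[OF G'(2)] obtain \<phi> where
      \<phi>: "\<forall>u v. {u, v} \<in> edges G \<longrightarrow> {\<phi> u, \<phi> v} \<in> edges G'" ..
    have "proper_colouring G 2 (\<lambda>v. if \<phi> v < ?k then 0 else 1)"
      using \<phi> G'(1) by (fastforce simp: proper_colouring_def K_def doubleton_eq_iff)
    then have "chromatic_number G \<le> 2"
      unfolding chromatic_number_def by (intro Least_le) blast
    with assms show False by simp
  qed
  have card_K: "card (verts K) = n" by (simp add: K_def)
  have le: "card (edges K) \<le> ex n G" using simple card_K free by (rule card_edges_le_ex)
  with large have n: "n * (n - 1) \<le> 4 * ex n G" by simp
  show ?thesis
  proof (cases rule: ex_cases[of n G])
    case 1
    \<comment> \<open>If \<open>ex n G\<close> is 0, then \<open>K\<close> has no edges and is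
      itself extremal.\<close>
    then show ?thesis using that[OF simple card_K free] le n by simp
  next
    case (2 H)
    then show ?thesis using that n by blast
  qed
qed

text \<open>An edge meeting \<open>e\<close> is determined by an end in \<open>e\<close> and its
  other end, which leaves at most \<open>2 * card (verts H)\<close> choices.\<close>

lemma card_edges_meeting_le:
  assumes "simple_graph H" "e \<in> edges H"
  shows "card {g \<in> edges H. g \<inter> e \<noteq> {}} \<le> 2 * card (verts H)"
proof -
  have H: "finite (verts H)" "\<And>g. g \<in> edges H \<Longrightarrow> g \<subseteq> verts H \<and> card g = 2"
    using assms(1) by (auto simp: simple_graph_def)
  have "{g \<in> edges H. g \<inter> e \<noteq> {}} \<subseteq> (\<lambda>(i, j). {i, j}) ` (e \<times> verts H)"
  proof clarify
    fix g assume g: "g \<in> edges H" "g \<inter> e \<noteq> {}"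
    then obtain x where x: "x \<in> g" "x \<in> e" by blast
    moreover obtain y where "g = {x, y}" using H(2)[OF g(1)] x(1) by (auto simp: card_2_iff)
    ultimately show "g \<in> (\<lambda>(i, j). {i, j}) ` (e \<times> verts H)" using H(2)[OF g(1)] by auto
  qed
  then have "card {g \<in> edges H. g \<inter> e \<noteq> {}} \<le> card (e \<times> verts H)"
    using H assms(2) finite_subset by (intro surj_card_le) (auto intro: finite_subset)
  then show ?thesis using H(2)[OF assms(2)] by (simp add: card_cartesian_product)
qed

text \<open>An extremal \<open>G\<close>-free graph has too many edges for all of them to meet a
  given edge, so every edge has a disjoint partner. Any choice of partners lies in
  \<open>F0\<close>, and without copies of \<open>G\<close> there are no exclusive ones.\<close>

lemma ex_le_s:
  assumes "chromatic_number G \<ge> 3" "n \<ge> 10"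
  shows "ex n G \<le> s n G"
proof -
  from ex_ge_of_chromatic_number[OF assms(1), of n] obtain H :: "nat ugraph" where
    H: "simple_graph H" "card (verts H) = n" "\<nexists>G'. is_copy G H G'" "card (edges H) = ex n G"
      "n * (n - 1) \<le> 4 * ex n G" .
  \<comment> \<open>The bound 10 on \<open>n\<close> serves here: \<open>n - 1\<close> must exceed 8
    for \<open>ex n G\<close> to exceed \<open>2 * n\<close>.\<close>
  have "8 * n < n * (n - 1)" using assms(2) by simp
  then have large: "2 * n < card (edges H)" using H(4,5) by linarith
  have "\<exists>g\<in>edges H. g \<inter> e = {}" if "e \<in> edges H" for e
  proof (rule ccontr)
    assume "\<not> ?thesis"
    then have "{g \<in> edges H. g \<inter> e \<noteq> {}} = edges H" by blast
    with card_edges_meeting_le[OF H(1) that] large H(2) show False by simp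
  qed
  then obtain g where "\<And>e. e \<in> edges H \<Longrightarrow> g e \<in> edges H \<and> g e \<inter> e = {}" by metis
  then have "restrict g (edges H) \<in> F0 H" by (auto simp: F0_def)
  then show ?thesis using card_edges_le_s[of H n _ G] H by metis
qed

section \<open>Bipartite graphs: the Kovari-Sos-Turan bound\<close>

text \<open>Any injections of \<open>A\<close> into \<open>X\<close> and of \<open>B\<close> into
  \<open>Y\<close> combine to an embedding, because all edges between \<open>X\<close> and
  \<open>Y\<close> are present.\<close>

lemma bipartite_copy_of_complete:
  assumes "simple_graph G" "A \<union> B = verts G" "A \<inter> B = {}"
    and AB: "\<forall>e\<in>edges G. \<exists>a\<in>A. \<exists>b\<in>B. e = {a, b}"
    and H: "simple_graph H"
    and X: "finite X" "card A \<le> card X" "X \<subseteq> verts H"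
    and Y: "finite Y" "card B \<le> card Y" "Y \<subseteq> verts H"
    and XY: "\<And>x y. x \<in> X \<Longrightarrow> y \<in> Y \<Longrightarrow> {x, y} \<in> edges H"
  shows "\<exists>G'. is_copy G H G'"
proof -
  have "finite (verts G)" using assms(1) by (simp add: simple_graph_def)
  then have fin: "finite A" "finite B" using assms(2) by (auto intro: finite_subset)
  obtain p where p: "p ` A \<subseteq> X" "inj_on p A" using card_le_inj[OF fin(1) X(1,2)] by blast
  obtain q where q: "q ` B \<subseteq> Y" "inj_on q B" using card_le_inj[OF fin(2) Y(1,2)] by blast
  \<comment> \<open>A common element \<open>x\<close> would make \<open>{x, x}\<close>, a set of
    size 1, an edge.\<close>
  have "X \<inter> Y = {}"
    using XY H by (force simp: simple_graph_def)
  define \<phi> where "\<phi> = (\<lambda>v. if v \<in> A then p v else q v)"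
  have \<phi>A: "\<phi> a = p a" if "a \<in> A" for a using that by (simp add: \<phi>_def)
  have \<phi>B: "\<phi> b = q b" if "b \<in> B" for b using that assms(3) by (auto simp: \<phi>_def)
  have inj: "inj_on \<phi> (verts G)"
    unfolding assms(2)[symmetric]
  proof (intro inj_on_Un[THEN iffD2] conjI)
    show "inj_on \<phi> A" using p(2) \<phi>A by (simp cong: inj_on_cong)
    show "inj_on \<phi> B" using q(2) \<phi>B by (simp cong: inj_on_cong)
    have "\<phi> ` (A - B) \<subseteq> X" "\<phi> ` (B - A) \<subseteq> Y" using \<phi>A \<phi>B p q by auto
    then show "\<phi> ` (A - B) \<inter> \<phi> ` (B - A) = {}" using \<open>X \<inter> Y = {}\<close> by blast
  qed
  define G' where "G' = (\<phi> ` verts G, (\<lambda>e. \<phi> ` e) ` edges G)"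
  have V: "verts G' \<subseteq> verts H"
    using p q X Y \<phi>A \<phi>B by (auto simp: G'_def assms(2)[symmetric] image_subset_iff)
  have E: "edges G' \<subseteq> edges H"
  proof
    fix g assume "g \<in> edges G'"
    then obtain e where e: "e \<in> edges G" "g = \<phi> ` e" by (auto simp: G'_def)
    with AB obtain a b where "a \<in> A" "b \<in> B" "e = {a, b}" by metis
    then show "g \<in> edges H" using e XY p q \<phi>A \<phi>B by (auto simp: image_subset_iff)
  qed
  have "simple_graph G'"
    unfolding simple_graph_def
  proof (intro conjI ballI)
    show "finite (verts G')" using \<open>finite (verts G)\<close> by (simp add: G'_def)
    fix g assume g: "g \<in> edges G'"
    then show "card g = 2" using E H by (auto simp: simple_graph_def)
    from g obtain e where "e \<in> edges G" "g = \<phi> ` e" by (auto simp: G'_def)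
    moreover have "e \<subseteq> verts G" using \<open>e \<in> edges G\<close> assms(1) by (simp add: simple_graph_def)
    ultimately show "g \<subseteq> verts G'" by (simp add: G'_def image_mono)
  qed
  moreover have "isomorphic G G'"
    using inj by (auto simp: isomorphic_def G'_def bij_betw_def)
  ultimately show ?thesis using V E unfolding is_copy_def subgraph_def by blast
qed

text \<open>Handshake lemma: the map from \<open>w\<close> to \<open>{v, w}\<close> identifies
  neighbours of \<open>v\<close> with edges at \<open>v\<close>, and each edge is then counted at
  both ends.\<close>

lemma sum_degrees:
  assumes "simple_graph H"
  shows "(\<Sum>v\<in>verts H. card {w. {v, w} \<in> edges H}) = 2 * card (edges H)"
proof -
  have fin: "finite (verts H)" "finite (edges H)"
    using assms simple_graph_finite_edges[OF assms] by (simp_all add: simple_graph_def)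
  have "card {w. {v, w} \<in> edges H} = card {e \<in> edges H. v \<in> e}" for v
  proof -
    have "\<exists>w. e = {v, w}" if "e \<in> edges H" "v \<in> e" for e
    proof -
      have "card e = 2" using assms that(1) by (simp add: simple_graph_def)
      then obtain x y where "e = {x, y}" by (auto simp: card_2_iff)
      with that(2) show ?thesis by (auto simp: insert_commute)
    qed
    then have "{e \<in> edges H. v \<in> e} = (\<lambda>w. {v, w}) ` {w. {v, w} \<in> edges H}" by blast
    moreover have "inj (\<lambda>w. {v, w})" by (auto simp: inj_on_def doubleton_eq_iff)
    ultimately show ?thesis by (simp add: card_image inj_on_subset)
  qed
  then have "(\<Sum>v\<in>verts H. card {w. {v, w} \<in> edges H}) = (\<Sum>v\<in>verts H. card {e \<in> edges H. v \<in> e})"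
    by simp
  also have "\<dots> = (\<Sum>e\<in>edges H. card {v \<in> verts H. v \<in> e})"
    using fin by (rule sum_card_filter_swap)
  also have "\<dots> = (\<Sum>e\<in>edges H. 2)"
  proof (rule sum.cong)
    fix e assume "e \<in> edges H"
    then have "{v \<in> verts H. v \<in> e} = e" "card e = 2" using assms by (auto simp: simple_graph_def)
    then show "card {v \<in> verts H. v \<in> e} = 2" by simp
  qed simp
  finally show ?thesis by simp
qed

text \<open>The Kovari--Sos--Turan argument: many vertices have large degree, so some \<open>t\<close>-set
  lies in the neighbourhoods of \<open>t\<close> of them.\<close>

lemma kovari_sos_turan:
  assumes H: "simple_graph H" "card (verts H) = n" and t: "t > 0" and c: "c > 0"
    and dense: "real (card (edges H)) > c * real n ^ 2"
    and n: "c * real n \<ge> real t" "c * real n * (c / t) ^ t > t"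
  obtains X Y where "X \<subseteq> verts H" "Y \<subseteq> verts H" "card X = t" "card Y \<ge> t" "finite Y"
    "\<And>x y. x \<in> X \<Longrightarrow> y \<in> Y \<Longrightarrow> {x, y} \<in> edges H"
proof -
  let ?V = "verts H"
  let ?N = "\<lambda>v. {w. {v, w} \<in> edges H}"
  let ?T = "{T. T \<subseteq> ?V \<and> card T = t}"
  let ?big = "{v \<in> ?V. c * real n \<le> real (card (?N v))}"
  have fV: "finite ?V" using H by (simp add: simple_graph_def)
  have NV: "?N v \<subseteq> ?V" for v using H by (auto simp: simple_graph_def)
  have fN: "finite (?N v)" for v using NV fV finite_subset by blast
  have npos: "n > 0" using n(1) t c by (cases n) auto
  have many: "c * real n \<le> real (card ?big)"
  proof -
    have "2 * c * real n ^ 2 \<le> real (\<Sum>v\<in>?V. card (?N v))"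
      using dense sum_degrees[OF H(1)] by simp
    \<comment> \<open>Vertices of degree below \<open>c * n\<close> contribute at most half of the
      lower bound \<open>2 * c * n ^ 2\<close>. The vertices in \<open>?big\<close> must supply the
      other half, at an excess of at most \<open>n\<close> each.\<close>
    also have "\<dots> \<le> (\<Sum>v\<in>?V. c * real n + (if v \<in> ?big then real n else 0))"
      unfolding of_nat_sum
    proof (rule sum_mono)
      fix v assume v: "v \<in> ?V"
      have "real (card (?N v)) \<le> real n" using card_mono[OF fV NV] H(2) by simp
      then show "real (card (?N v)) \<le> c * real n + (if v \<in> ?big then real n else 0)"
        using v c by (auto simp: add_increasing)
    qed
    also have "\<dots> = c * real n ^ 2 + real (card ?big) * real n"
      using fV H(2) by (simp add: sum.distrib sum.If_cases power2_eq_square Int_def)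
    finally have "(c * real n) * real n \<le> real (card ?big) * real n"
      by (simp add: power2_eq_square)
    then show ?thesis using npos by simp
  qed
  \<comment> \<open>Pairs of a vertex \<open>v\<close> and a \<open>t\<close>-set \<open>T\<close>
    inside its neighbourhood are counted in two ways. If every \<open>T\<close> had fewer than
    \<open>t\<close> common neighbours, there would be at most \<open>t * n ^ t\<close> pairs, but
    the vertices in \<open>?big\<close> alone yield at least
    \<open>c * n * (c * n / t) ^ t\<close>.\<close>
  have "\<exists>T\<in>?T. t \<le> card {v \<in> ?V. T \<subseteq> ?N v}"
  proof (rule ccontr)
    assume "\<not> ?thesis"
    then have small: "card {v \<in> ?V. T \<subseteq> ?N v} \<le> t" if "T \<in> ?T" for T using that by force
    \<comment> \<open>Needed for \<open>binomial_le_pow\<close> below; a vertex in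
      \<open>?big\<close> already has at least \<open>t\<close> neighbours.\<close>
    have tn: "t \<le> n"
    proof -
      have "c * real n > 0" using npos c by simp
      then have "card ?big > 0" using many by linarith
      then have "?big \<noteq> {}" by (metis card.empty less_irrefl)
      then obtain v where "v \<in> ?big" by blast
      then have "real t \<le> real (card (?N v))" using order_trans[OF n(1)] by blast
      then show ?thesis using card_mono[OF fV NV[of v]] H(2) by simp
    qed
    have "c * real n * (c * real n / t) ^ t \<le> (\<Sum>v\<in>?big. (c * real n / t) ^ t)"
      using many c by (simp add: mult_right_mono)
    also have "\<dots> \<le> (\<Sum>v\<in>?big. real (card (?N v) choose t))"
    proof (rule sum_mono)
      fix v assume v: "v \<in> ?big"
      then have "real t \<le> real (card (?N v))" using order_trans[OF n(1)] by blast
      then have "t \<le> card (?N v)" by simp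
      then have "(real (card (?N v)) / real t) ^ t \<le> real (card (?N v) choose t)"
        by (rule binomial_ge_n_over_k_pow_k)
      moreover have "(c * real n / t) ^ t \<le> (real (card (?N v)) / real t) ^ t"
        using v c by (intro power_mono divide_right_mono) auto
      ultimately show "(c * real n / t) ^ t \<le> real (card (?N v) choose t)" by linarith
    qed
    also have "\<dots> \<le> (\<Sum>v\<in>?V. real (card (?N v) choose t))"
      using fV by (intro sum_mono2) auto
    also have "\<dots> = real (\<Sum>v\<in>?V. card {T \<in> ?T. T \<subseteq> ?N v})"
      unfolding of_nat_sum
    proof (rule sum.cong)
      fix v
      have "{T \<in> ?T. T \<subseteq> ?N v} = {T. T \<subseteq> ?N v \<and> card T = t}" using NV by blast
      then show "real (card (?N v) choose t) = real (card {T \<in> ?T. T \<subseteq> ?N v})"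
        using fN by (simp add: n_subsets)
    qed simp
    also have "(\<Sum>v\<in>?V. card {T \<in> ?T. T \<subseteq> ?N v}) = (\<Sum>T\<in>?T. card {v \<in> ?V. T \<subseteq> ?N v})"
      using fV by (intro sum_card_filter_swap) auto
    also have "real \<dots> \<le> real (\<Sum>T\<in>?T. t)" using small by (intro of_nat_mono sum_mono)
    also have "\<dots> = real (n choose t) * real t" using fV H(2) by (simp add: n_subsets)
    also have "\<dots> \<le> real n ^ t * real t"
      using binomial_le_pow[OF tn] by (intro mult_right_mono) (simp_all flip: of_nat_power)
    finally have "(c * real n * (c / t) ^ t) * real n ^ t \<le> real t * real n ^ t"
      by (simp add: power_divide power_mult_distrib mult_ac)
    then show False using n(2) npos by simp
  qed
  then obtain T where T: "T \<subseteq> ?V" "card T = t" "t \<le> card {v \<in> ?V. T \<subseteq> ?N v}" by blast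
  show ?thesis
    by (rule that[of T "{v \<in> ?V. T \<subseteq> ?N v}"]) (use T fV in \<open>auto simp: insert_commute\<close>)
qed

text \<open>A denser graph would contain a complete bipartite graph with at least \<open>t\<close>
  vertices on each side, where \<open>t\<close> exceeds the sizes of both classes of
  \<open>G\<close>, and hence a copy of \<open>G\<close>. The successor in \<open>t\<close> keeps it
  positive even when \<open>G\<close> has no vertices.\<close>

lemma ex_bipartite:
  assumes "simple_graph G" "bipartite G" "c > 0"
  shows "eventually (\<lambda>n. real (ex n G) \<le> c * real n ^ 2) at_top"
proof -
  from assms(2) obtain A B where AB: "A \<union> B = verts G" "A \<inter> B = {}"
    "\<forall>e\<in>edges G. \<exists>a\<in>A. \<exists>b\<in>B. e = {a, b}"
    unfolding bipartite_def by (elim exE conjE)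
  define t where "t = Suc (card A + card B)"
  have "eventually (\<lambda>n. c * real n * d > real t) at_top" if "d > 0" for d
    using assms(3) that by real_asymp
  from this[of "(c / t) ^ t"] have "eventually (\<lambda>n. c * real n * (c / t) ^ t > t) at_top"
    using assms(3) by (simp add: t_def)
  moreover have "eventually (\<lambda>n. c * real n \<ge> real t) at_top"
    using assms(3) by real_asymp
  ultimately have "eventually (\<lambda>n. c * real n \<ge> real t \<and> c * real n * (c / t) ^ t > t) at_top"
    by eventually_elim simp
  then show ?thesis
  proof eventually_elim
    case (elim n)
    show ?case
    proof (cases rule: ex_cases[of n G])
      case 1
      then show ?thesis using assms(3) by simp
    next
      case (2 H)
      show ?thesis
      proof (rule ccontr)
        assume "\<not> ?thesis"
        then have dense: "real (card (edges H)) > c * real n ^ 2" using 2(4) by simp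
        have "t > 0" by (simp add: t_def)
        from kovari_sos_turan[OF 2(1,2) this assms(3) dense] elim obtain X Y where
          XY: "X \<subseteq> verts H" "Y \<subseteq> verts H" "card X = t" "card Y \<ge> t" "finite Y"
          "\<And>x y. x \<in> X \<Longrightarrow> y \<in> Y \<Longrightarrow> {x, y} \<in> edges H" by metis
        have "finite X" using XY(3) \<open>t > 0\<close> card_ge_0_finite by metis
        with bipartite_copy_of_complete[OF assms(1) AB 2(1), of X Y] XY 2(3)
        show False by (auto simp: t_def)
      qed
    qed
  qed
qed

section \<open>Passage to the limit\<close>

theorem theorem4p1:
  fixes G :: "'a ugraph"
  assumes "simple_graph G"
  shows "(chromatic_number G \<ge> 3 \<longrightarrow>
            (\<lambda>n. real (s n G)) \<sim>[at_top] (\<lambda>n. real (ex n G))) \<and>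
         (bipartite G \<longrightarrow> (\<lambda>n. real (s n G)) \<in> o[at_top](\<lambda>n. real n ^ 2))"
proof (intro conjI impI)
  assume chi: "chromatic_number G \<ge> 3"
  let ?r = "\<lambda>m. real (ex m G) / (real m * (real m - 1))"
  \<comment> \<open>\<open>L\<close> is half the Turan density of \<open>G\<close>, taken as an
    infimum so that \<open>ex n G\<close> is at least \<open>L * n * (n - 1)\<close> for every
    \<open>n\<close> from 2 on.\<close>
  define L where "L = (INF m\<in>{2..}. ?r m)"
  have r_ge: "?r m \<ge> 1 / 4" if "m \<ge> 2" for m
  proof -
    have "m * (m - 1) \<le> 4 * ex m G" using ex_ge_of_chromatic_number[OF chi] by blast
    then have "real (m * (m - 1)) \<le> real (4 * ex m G)" by (rule of_nat_mono)
    then show ?thesis using that by (simp add: field_simps of_nat_diff)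
  qed
  have bdd: "bdd_below (?r ` {2..})" using r_ge by (intro bdd_belowI2[where m = "1 / 4"]) auto
  have "1 / 4 \<le> L"
    unfolding L_def using r_ge by (intro cINF_greatest) auto
  then have L: "L > 0" by linarith
  have L_le: "L \<le> ?r m" if "m \<ge> 2" for m
    using that unfolding L_def by (intro cINF_lower bdd) auto
  have upper: "eventually (\<lambda>n. real (s n G) / real (ex n G) \<le> 1 + \<epsilon>) at_top" if "\<epsilon> > 0" for \<epsilon>
  proof -
    \<comment> \<open>Otherwise \<open>L * (1 + \<epsilon>)\<close> would be a lower bound of the
      ratios above their infimum, as \<open>L\<close> is positive. One such \<open>m\<close> bounds
      \<open>s n G\<close> for all large \<open>n\<close>.\<close>
    have "\<exists>m\<ge>2. ?r m < L * (1 + \<epsilon>)"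
    proof (rule ccontr)
      assume "\<not> ?thesis"
      then have "L * (1 + \<epsilon>) \<le> L"
        by (subst (2) L_def, intro cINF_greatest) (auto simp: not_less)
      then show False using L that by (simp add: mult_le_cancel_left1)
    qed
    then obtain m where m: "m \<ge> 2" "?r m < L * (1 + \<epsilon>)" by blast
    then have "real (ex m G) < L * (1 + \<epsilon>) * (real m * (real m - 1))"
      by (simp add: divide_less_eq)
    from eventually_s_le[OF m(1) this] eventually_ge_at_top[of 2] show ?thesis
    proof eventually_elim
      case (elim n)
      have N: "real n * (real n - 1) > 0" using elim(2) by simp
      have L': "L * (real n * (real n - 1)) \<le> real (ex n G)"
        using L_le[OF elim(2)] N by (simp only: pos_le_divide_eq)
      then have ex: "real (ex n G) > 0" using mult_pos_pos[OF L N] by linarith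
      have "real (s n G) \<le> (1 + \<epsilon>) * (L * (real n * (real n - 1)))" using elim(1) by (simp add: mult_ac)
      also have "\<dots> \<le> (1 + \<epsilon>) * real (ex n G)" using L' that by (intro mult_left_mono) auto
      finally show ?case using ex by (simp add: pos_divide_le_eq)
    qed
  qed
  have lower: "eventually (\<lambda>n. 1 \<le> real (s n G) / real (ex n G)) at_top"
    using eventually_ge_at_top[of 10]
  proof eventually_elim
    case (elim n)
    \<comment> \<open>Positivity matters for the quotient: division by 0 would give 0.\<close>
    have "ex n G > 0"
    proof (rule ccontr)
      assume "\<not> ?thesis"
      then have "?r n = 0" by simp
      with r_ge[of n] elim show False by linarith
    qed
    with ex_le_s[OF chi elim] show ?case by simp
  qed
  show "(\<lambda>n. real (s n G)) \<sim>[at_top] (\<lambda>n. real (ex n G))"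
  proof (rule asymp_equivI', rule tendstoI)
    fix \<epsilon> :: real assume "\<epsilon> > 0"
    \<comment> \<open>Halving turns the weak bound in \<open>upper\<close> into the strict one
      required by \<open>tendstoI\<close>.\<close>
    then have "\<epsilon> / 2 > 0" by simp
    from upper[OF this] lower show "eventually (\<lambda>n. dist (real (s n G) / real (ex n G)) 1 < \<epsilon>) at_top"
      by eventually_elim (use \<open>\<epsilon> > 0\<close> in \<open>simp add: dist_real_def\<close>)
  qed
next
  assume bip: "bipartite G"
  show "(\<lambda>n. real (s n G)) \<in> o[at_top](\<lambda>n. real n ^ 2)"
  proof (rule landau_o.smallI)
    fix c :: real assume c: "c > 0"
    \<comment> \<open>The factor 1/4 pays for replacing \<open>m ^ 2\<close> by
      \<open>m * (m - 1)\<close>: for \<open>m \<ge> 2\<close>, \<open>m\<close> is less than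
      \<open>4 * (m - 1)\<close>. A single large \<open>m\<close> then suffices for
      \<open>eventually_s_le\<close>.\<close>
    have "eventually (\<lambda>n. real (ex n G) \<le> c / 4 * real n ^ 2) at_top"
      using ex_bipartite[OF assms bip, of "c / 4"] c by simp
    then have "eventually (\<lambda>m. m \<ge> 2 \<and> real (ex m G) \<le> c / 4 * real m ^ 2) at_top"
      using eventually_ge_at_top[of 2] by eventually_elim auto
    then obtain m where m: "m \<ge> 2" "real (ex m G) \<le> c / 4 * real m ^ 2"
      using eventually_happens' sequentially_bot by blast
    have "c / 4 * real m ^ 2 < c * (real m * (real m - 1))"
    proof -
      have "real m * real m < real m * (4 * (real m - 1))" using m(1) by (intro mult_strict_left_mono) auto
      then have "c * (real m * real m) < c * (real m * (4 * (real m - 1)))"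
        using c by (rule mult_strict_left_mono)
      also have "\<dots> = 4 * (c * (real m * (real m - 1)))" by (simp only: mult_ac)
      finally show ?thesis unfolding power2_eq_square by linarith
    qed
    with m have "real (ex m G) < c * (real m * (real m - 1))" by linarith
    from eventually_s_le[OF m(1) this]
    show "eventually (\<lambda>n. norm (real (s n G)) \<le> c * norm (real n ^ 2)) at_top"
    proof eventually_elim
      case (elim n)
      have "c * (real n * (real n - 1)) \<le> c * real n ^ 2"
        using c by (intro mult_left_mono) (auto simp: power2_eq_square algebra_simps)
      with elim show ?case by simp
    qed
  qed
qed

end
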